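(* Let $A_1,\dots,A_m$ be real symmetric $n\times n$ matrices and suppose there exists $\lambda\in\mathbb{R}^m$ such that $\lambda_1A_1+\lambda_2A_2+\cdots+\lambda_mA_m\succ0$, where, without loss of generality, $\lambda_m\ne0$. Let $P$ be any nonsingular real $n\times n$ matrix such that $P^T(\lambda_1A_1+\lambda_2A_2+\cdots+\lambda_mA_m)P=I$. Then $A_1,A_2,\dots,A_m$ are simultaneously diagonalizable via congruence if and only if $P^TA_iP$ commutes with $P^TA_jP$ for all $i\neq j$, $1\le i,j\le m-1$.
   Context: Real symmetric $n\times n$ matrices $M_1,\dots,M_k$ are called simultaneously diagonalizable via congruence (SD) if there exists a nonsingular real $n\times n$ matrix $S$ such that $S^TM_iS$ is diagonal for every $i$. $M\succ0$ means that $M$ is positive definite; $I$ is the identity matrix. *)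

theory Defs
  imports "HOL-Analysis.Analysis"
begin

definition symmetric_matrix :: "real^'n^'n \<Rightarrow> bool" where
  "symmetric_matrix M \<longleftrightarrow> transpose M = M"

definition diagonal_matrix :: "real^'n^'n \<Rightarrow> bool" where
  "diagonal_matrix M \<longleftrightarrow> (\<forall>i j. i \<noteq> j \<longrightarrow> M $ i $ j = 0)"

definition positive_definite :: "real^'n^'n \<Rightarrow> bool" where
  "positive_definite M \<longleftrightarrow> symmetric_matrix M \<and> (\<forall>x. x \<noteq> 0 \<longrightarrow> x \<bullet> (M *v x) > 0)"

(* The family consists of M 1, ..., M k; values of M outside {1..k} play no role.
   The notion is meant for symmetric matrices only; that is a hypothesis where it is used. *)
definition simultaneously_diagonalizable_via_congruence ::
    "nat \<Rightarrow> (nat \<Rightarrow> real^'n^'n) \<Rightarrow> bool" where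
  "simultaneously_diagonalizable_via_congruence k M \<longleftrightarrow>
     (\<exists>S::real^'n^'n. invertible S \<and>
        (\<forall>i\<in>{1..k}. diagonal_matrix (transpose S ** M i ** S)))"

definition commuting_matrices :: "real^'n^'n \<Rightarrow> real^'n^'n \<Rightarrow> bool" where
  "commuting_matrices X Y \<longleftrightarrow> X ** Y = Y ** X"

end

theory Submission
  imports Defs
begin

text \<open>
  Congruence by \<open>P\<close> turns the positive definite combination into the identity, so it is enough to
  understand the matrices \<open>B i = transpose P ** A i ** P\<close>, for which \<open>\<Sum>i. l i *\<^sub>R B i = mat 1\<close>.

  If some \<open>S\<close> diagonalizes every \<open>A i\<close>, then the \<open>T\<close> with \<open>P ** T = S\<close> diagonalizes every \<open>B i\<close> and,
  because the identity is a combination of the \<open>B i\<close>, also \<open>transpose T ** T\<close>. The columns of \<open>T\<close> are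
  therefore orthogonal, and they form a basis of common eigenvectors of the \<open>B i\<close>; matrices with a
  common eigenbasis commute (\<open>commuting_if_congruent_to_diagonal\<close>).

  Conversely, commuting symmetric matrices have a common orthonormal eigenbasis, that is, an
  orthogonal \<open>Q\<close> makes \<open>transpose Q ** B i ** Q\<close> diagonal for every \<open>i < m\<close>
  (\<open>commuting_symmetric_orthogonally_diagonalizable\<close>). The matrix \<open>B m\<close> comes for free: since
  \<open>l m \<noteq> 0\<close>, it is a combination of the identity and of the other \<open>B i\<close>, which \<open>Q\<close> all
  makes diagonal. So \<open>P ** Q\<close> diagonalizes the whole family.

  The common eigenbasis is found by splitting the space: as long as one of the maps is not a
  multiple of the identity, one of its eigenspaces and the orthogonal complement of that eigenspace
  are smaller subspaces that the whole family leaves invariant. That a self-adjoint map has an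
  eigenvector at all is the maximum principle for its Rayleigh quotient.
\<close>

section \<open>Common eigenbases of commuting self-adjoint maps\<close>

text \<open>
  A maximizer \<open>x\<close> of \<open>x \<bullet> f x\<close> on the unit sphere of \<open>V\<close>, with maximum \<open>c\<close>, is an eigenvector:
  the form \<open>q y = c * (y \<bullet> y) - y \<bullet> f y\<close> is nonnegative on \<open>V\<close> and vanishes at \<open>x\<close>, hence its
  derivative there vanishes in every direction of \<open>V\<close>, in particular in the direction
  \<open>c *\<^sub>R x - f x\<close>.
\<close>
lemma selfadjoint_has_eigenvector_in_subspace:
  fixes f :: "'a::euclidean_space \<Rightarrow> 'a"
  assumes lin: "linear f" and sa: "\<And>x y. f x \<bullet> y = x \<bullet> f y"
    and V: "subspace V" and inv: "\<And>x. x \<in> V \<Longrightarrow> f x \<in> V"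
    and v: "v \<in> V" "v \<noteq> 0"
  obtains x c where "x \<in> V" "x \<noteq> 0" "f x = c *\<^sub>R x"
proof -
  let ?K = "sphere 0 1 \<inter> V"
  have "compact ?K"
    by (intro compact_Int_closed compact_sphere closed_subspace V)
  moreover have "(1 / norm v) *\<^sub>R v \<in> ?K"
    using v V by (auto simp: subspace_scale)
  moreover have "continuous_on ?K (\<lambda>x. x \<bullet> f x)"
    by (intro continuous_intros linear_continuous_on linear_conv_bounded_linear[THEN iffD1] lin)
  ultimately obtain x where x: "x \<in> ?K" and max: "\<And>y. y \<in> ?K \<Longrightarrow> y \<bullet> f y \<le> x \<bullet> f x"
    using continuous_attains_sup[of ?K "\<lambda>x. x \<bullet> f x"] by blast
  define c where "c = x \<bullet> f x"
  have xx: "x \<bullet> x = 1" and xV: "x \<in> V"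
    using x by (auto simp: norm_eq_1)
  have nonneg: "0 \<le> c * (y \<bullet> y) - y \<bullet> f y" if "y \<in> V" for y
  proof (cases "y = 0")
    case False
    define u where "u = (1 / norm y) *\<^sub>R y"
    have "u \<in> ?K"
      using that False V by (auto simp: u_def subspace_scale)
    then have "u \<bullet> f u \<le> c"
      using max by (simp add: c_def)
    moreover have "y = norm y *\<^sub>R u"
      using False by (simp add: u_def)
    then have "y \<bullet> f y = (norm y)\<^sup>2 * (u \<bullet> f u)"
      by (metis inner_scaleR_left inner_scaleR_right lin linear_scale mult.assoc power2_eq_square)
    ultimately show ?thesis
      by (simp add: dot_square_norm mult.commute[of "(norm y)\<^sup>2"] mult_right_mono)
  qed simp
  define w where "w = c *\<^sub>R x - f x"
  have wV: "w \<in> V"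
    using xV inv V by (simp add: w_def subspace_diff subspace_scale)
  define b where "b = c * (w \<bullet> w) - w \<bullet> f w"
  have b: "0 \<le> b"
    using nonneg[OF wV] by (simp add: b_def)
  have quadratic: "0 \<le> 2 * t * (w \<bullet> w) + t\<^sup>2 * b" for t
  proof -
    have "0 \<le> c * ((x + t *\<^sub>R w) \<bullet> (x + t *\<^sub>R w)) - (x + t *\<^sub>R w) \<bullet> f (x + t *\<^sub>R w)"
      using nonneg xV wV V by (simp add: subspace_add subspace_scale)
    also have "\<dots> = (c * (x \<bullet> x) - x \<bullet> f x) + 2 * t * (c * (x \<bullet> w) - f x \<bullet> w) + t\<^sup>2 * b"
      using sa[of x w]
      by (simp add: b_def linear_add[OF lin] linear_scale[OF lin] inner_add_left inner_add_right
          inner_commute power2_eq_square algebra_simps)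
    also have "\<dots> = 2 * t * (w \<bullet> w) + t\<^sup>2 * b"
      by (simp add: xx c_def[symmetric]) (simp add: w_def inner_diff_left)
    finally show ?thesis .
  qed
  \<comment> \<open>A negative \<open>t\<close> so small that the linear term outweighs the quadratic one.\<close>
  have "w \<bullet> w = 0"
  proof (rule ccontr)
    assume "w \<bullet> w \<noteq> 0"
    then have pos: "0 < w \<bullet> w" by simp
    define t where "t = - (w \<bullet> w) / (b + 1)"
    have "t\<^sup>2 * b \<le> t\<^sup>2 * (b + 1)"
      by (simp add: mult_left_mono)
    also have "\<dots> = - t * (w \<bullet> w)"
      using b by (simp add: t_def power2_eq_square)
    finally have "0 \<le> t * (w \<bullet> w)"
      using quadratic[of t] by simp
    moreover have "t < 0"
      using pos b by (simp add: t_def)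
    ultimately show False
      using pos by (simp add: zero_le_mult_iff)
  qed
  then have "f x = c *\<^sub>R x"
    by (simp add: w_def)
  moreover have "x \<noteq> 0"
    using xx by auto
  ultimately show thesis
    using that xV by blast
qed

text \<open>
  Induction on the dimension of \<open>V\<close>. The eigenspace of one map is invariant under the others
  because they commute with it, and its orthogonal complement is invariant because they are
  self-adjoint. When every map is a multiple of the identity on \<open>V\<close>, any orthonormal basis works.
  The cardinality condition says that \<open>B\<close> spans \<open>V\<close>, in a form that adds up over complements.
\<close>
lemma commuting_selfadjoint_common_eigenbasis:
  fixes F :: "('a::euclidean_space \<Rightarrow> 'a) set"
  assumes lin: "\<And>f. f \<in> F \<Longrightarrow> linear f"
    and sa: "\<And>f x y. f \<in> F \<Longrightarrow> f x \<bullet> y = x \<bullet> f y"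
    and comm: "\<And>f g x. f \<in> F \<Longrightarrow> g \<in> F \<Longrightarrow> f (g x) = g (f x)"
    and "subspace V" and "\<And>f x. f \<in> F \<Longrightarrow> x \<in> V \<Longrightarrow> f x \<in> V"
  shows "\<exists>B. B \<subseteq> V \<and> finite B \<and> card B = dim V \<and> pairwise orthogonal B \<and>
           (\<forall>b\<in>B. norm b = 1) \<and> (\<forall>f\<in>F. \<forall>b\<in>B. \<exists>c. f b = c *\<^sub>R b)"
  using assms(4,5)
proof (induction "dim V" arbitrary: V rule: less_induct)
  case less
  note V = \<open>subspace V\<close> and inv = less.prems(2)
  show ?case
  proof (cases "\<forall>f\<in>F. \<exists>c. \<forall>x\<in>V. f x = c *\<^sub>R x")
    case True
    obtain B where B: "B \<subseteq> V" "pairwise orthogonal B" "\<And>x. x \<in> B \<Longrightarrow> norm x = 1"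
      "independent B" "card B = dim V"
      using orthonormal_basis_subspace[OF V] by metis
    then have "finite B"
      using independent_imp_finite by blast
    moreover have "\<forall>f\<in>F. \<forall>b\<in>B. \<exists>c. f b = c *\<^sub>R b"
      using True B(1) by blast
    ultimately show ?thesis
      using B by blast
  next
    case False
    then obtain f where f: "f \<in> F" and nonscalar: "\<And>c. \<exists>x\<in>V. f x \<noteq> c *\<^sub>R x"
      by blast
    obtain v where "v \<in> V" "v \<noteq> 0"
      using nonscalar[of 0] linear_0[OF lin[OF f]] by auto
    then obtain x c where x: "x \<in> V" "x \<noteq> 0" "f x = c *\<^sub>R x"
      using selfadjoint_has_eigenvector_in_subspace[OF lin[OF f] sa[OF f] V inv[OF f]] by metis
    define W where "W = {y \<in> V. f y = c *\<^sub>R y}"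
    define U where "U = {y \<in> V. \<forall>z\<in>W. orthogonal z y}"
    have W: "subspace W"
      using V by (auto simp: W_def subspace_def linear_0[OF lin[OF f]] linear_add[OF lin[OF f]]
          linear_scale[OF lin[OF f]] scaleR_add_right)
    have U: "subspace U"
      using V by (auto simp: U_def subspace_def orthogonal_clauses)
    have WV: "W \<subseteq> V" and UV: "U \<subseteq> V"
      by (auto simp: W_def U_def)
    have invW: "g y \<in> W" if "g \<in> F" "y \<in> W" for g y
      using that inv[of g y] comm[OF f, of g y] by (auto simp: W_def linear_scale[OF lin])
    have invU: "g y \<in> U" if "g \<in> F" "y \<in> U" for g y
      using that inv[of g y] invW[of g] sa[of g]
      by (auto simp: U_def orthogonal_def) metis
    have dim: "dim U + dim W = dim V"
      unfolding U_def by (rule dim_subspace_orthogonal_to_vectors[OF W V WV])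
    have dimW: "dim W < dim V"
    proof -
      have "W \<noteq> V"
        using nonscalar[of c] by (auto simp: W_def)
      then show ?thesis
        using WV W V by (metis dim_subset nat_less_le subspace_dim_equal order_refl)
    qed
    have "dim W \<noteq> 0"
      using x by (auto simp: W_def)
    then have dimU: "dim U < dim V"
      using dim by linarith
    obtain B where
      B: "B \<subseteq> W" "finite B" "card B = dim W" "pairwise orthogonal B"
        "\<forall>b\<in>B. norm b = 1" "\<forall>f\<in>F. \<forall>b\<in>B. \<exists>c. f b = c *\<^sub>R b"
      using less.hyps[OF dimW W] invW by blast
    obtain C where
      C: "C \<subseteq> U" "finite C" "card C = dim U" "pairwise orthogonal C"
        "\<forall>b\<in>C. norm b = 1" "\<forall>f\<in>F. \<forall>b\<in>C. \<exists>c. f b = c *\<^sub>R b"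
      using less.hyps[OF dimU U] invU by blast
    have BC: "orthogonal b d" if "b \<in> B" "d \<in> C" for b d
      using that B(1) C(1) by (auto simp: U_def)
    have CB: "orthogonal d b" if "b \<in> B" "d \<in> C" for b d
      using BC[OF that] orthogonal_commute by blast
    have "B \<inter> C = {}"
      using BC B(5) by (fastforce simp: orthogonal_self)
    then have "card (B \<union> C) = dim V"
      using B(2,3) C(2,3) dim by (simp add: card_Un_disjoint)
    moreover have "pairwise orthogonal (B \<union> C)"
      using B(4) C(4) BC CB by (auto simp: pairwise_def)
    moreover have "B \<union> C \<subseteq> V" "finite (B \<union> C)"
      using B C WV UV by auto
    moreover have "\<forall>b\<in>B \<union> C. norm b = 1" "\<forall>f\<in>F. \<forall>b\<in>B \<union> C. \<exists>c. f b = c *\<^sub>R b"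
      using B(5,6) C(5,6) by blast+
    ultimately show ?thesis
      by blast
  qed
qed

section \<open>Congruences of matrices\<close>

lemma congruence_entry:
  fixes M S :: "real^'n^'n"
  shows "(transpose S ** M ** S) $ i $ j = column i S \<bullet> (M *v column j S)"
proof -
  have "transpose S ** M ** S = transpose S ** (M ** S)"
    by (simp add: matrix_mul_assoc)
  then show ?thesis
    by (simp add: matrix_matrix_mult_def matrix_vector_mult_def transpose_def column_def
        inner_vec_def)
qed

lemma congruence_sum:
  fixes M :: "'i \<Rightarrow> real^'n^'n" and S :: "real^'n^'n"
  shows "transpose S ** (\<Sum>i\<in>I. l i *\<^sub>R M i) ** S = (\<Sum>i\<in>I. l i *\<^sub>R (transpose S ** M i ** S))"
proof -
  have "linear (\<lambda>M. transpose S ** M ** S)"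
    by (rule linearI) (simp_all add: vec_eq_iff congruence_entry matrix_vector_mult_add_rdistrib
        inner_add_right scaleR_matrix_vector_assoc[symmetric])
  from linear_sum[OF this, of "\<lambda>i. l i *\<^sub>R M i" I] show ?thesis
    by (simp add: linear_scale[OF \<open>linear _\<close>])
qed

lemma congruence_comp:
  fixes M P Q :: "real^'n^'n"
  shows "transpose (P ** Q) ** M ** (P ** Q) = transpose Q ** (transpose P ** M ** P) ** Q"
  by (simp add: matrix_transpose_mul matrix_mul_assoc)

lemma symmetric_matrix_congruence:
  "symmetric_matrix M \<Longrightarrow> symmetric_matrix (transpose P ** M ** P)"
  by (simp add: symmetric_matrix_def matrix_transpose_mul matrix_mul_assoc)

lemma symmetric_matrix_selfadjoint:
  "symmetric_matrix M \<Longrightarrow> (M *v x) \<bullet> y = x \<bullet> (M *v y)"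
  by (metis dot_lmul_matrix symmetric_matrix_def transpose_matrix_vector)

lemma diagonal_matrices_commute:
  "diagonal_matrix D \<Longrightarrow> diagonal_matrix E \<Longrightarrow> D ** E = E ** D"
  unfolding diagonal_matrix_def matrix_matrix_mult_def vec_eq_iff
  by (auto intro!: sum.cong) (metis mult.commute mult_zero_left mult_zero_right)

text \<open>
  The columns of \<open>Q\<close> are an enumeration of a common orthonormal eigenbasis.
\<close>
lemma commuting_symmetric_orthogonally_diagonalizable:
  fixes B :: "'i \<Rightarrow> real^'n^'n"
  assumes sym: "\<And>i. i \<in> I \<Longrightarrow> symmetric_matrix (B i)"
    and comm: "\<And>i j. i \<in> I \<Longrightarrow> j \<in> I \<Longrightarrow> commuting_matrices (B i) (B j)"
  obtains Q :: "real^'n^'n" where "orthogonal_matrix Q"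
    "\<And>i. i \<in> I \<Longrightarrow> diagonal_matrix (transpose Q ** B i ** Q)"
proof -
  let ?F = "(\<lambda>i. (*v) (B i)) ` I"
  have "\<exists>E. E \<subseteq> (UNIV :: (real^'n) set) \<and> finite E \<and> card E = dim (UNIV :: (real^'n) set) \<and>
      pairwise orthogonal E \<and> (\<forall>b\<in>E. norm b = 1) \<and> (\<forall>f\<in>?F. \<forall>b\<in>E. \<exists>c. f b = c *\<^sub>R b)"
    using sym comm
    by (intro commuting_selfadjoint_common_eigenbasis)
      (auto simp: symmetric_matrix_selfadjoint matrix_vector_mul_assoc commuting_matrices_def)
  then obtain E :: "(real^'n) set" where E: "finite E" "card E = CARD('n)" "pairwise orthogonal E"
      "\<forall>b\<in>E. norm b = 1" "\<forall>f\<in>?F. \<forall>b\<in>E. \<exists>c. f b = c *\<^sub>R b"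
    by (auto simp: dim_UNIV)
  then obtain e :: "'n \<Rightarrow> real^'n" where e: "bij_betw e UNIV E"
    using finite_same_card_bij[of "UNIV :: 'n set" E] by auto
  define Q :: "real^'n^'n" where "Q = (\<chi> i j. e j $ i)"
  have col: "column j Q = e j" for j
    by (simp add: Q_def column_def vec_eq_iff)
  have eE: "e j \<in> E" for j
    using e by (auto simp: bij_betw_def)
  have orth: "orthogonal (e i) (e j)" if "i \<noteq> j" for i j
    using E(3) e eE that by (metis pairwise_def bij_betw_def inj_eq)
  have "orthogonal_matrix Q"
    using orth E(4) eE by (simp add: orthogonal_matrix_orthonormal_columns col)
  moreover have "diagonal_matrix (transpose Q ** B i ** Q)" if "i \<in> I" for i
  proof -
    have "\<exists>c. B i *v e j = c *\<^sub>R e j" for j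
      using E(5) eE that by auto
    then show ?thesis
      using orth unfolding diagonal_matrix_def congruence_entry col orthogonal_def
      by (metis inner_scaleR_right mult_zero_right)
  qed
  ultimately show thesis
    using that by blast
qed

text \<open>
  With \<open>D = transpose T ** T\<close> invertible and diagonal, \<open>transpose T ** B ** T = D ** E\<close> for a diagonal
  \<open>E\<close>, and cancelling \<open>transpose T\<close> leaves \<open>B ** T = T ** E\<close>.
\<close>
lemma diagonal_congruence_imp_eigenvector_columns:
  fixes B T :: "real^'n^'n"
  assumes T: "invertible T" and D: "diagonal_matrix (transpose T ** T)"
    and B: "diagonal_matrix (transpose T ** B ** T)"
  obtains E where "diagonal_matrix E" "B ** T = T ** E"
proof -
  define D where "D = transpose T ** T"
  define E :: "real^'n^'n" where "E = (\<chi> i j. (transpose T ** B ** T) $ i $ j / D $ i $ i)"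
  have "det D \<noteq> 0"
    using T by (simp add: D_def det_mul invertible_det_nz)
  moreover have "det D = (\<Prod>i\<in>UNIV. D $ i $ i)"
    using D by (intro det_diagonal) (simp add: D_def diagonal_matrix_def)
  ultimately have nz: "D $ i $ i \<noteq> 0" for i
    by auto
  have "(D ** E) $ i $ j = (transpose T ** B ** T) $ i $ j" for i j
  proof -
    have "(D ** E) $ i $ j = (\<Sum>k\<in>UNIV. D $ i $ k * E $ k $ j)"
      by (simp add: matrix_matrix_mult_def)
    also have "\<dots> = (\<Sum>k\<in>UNIV. if k = i then D $ i $ i * E $ i $ j else 0)"
      using D by (intro sum.cong) (auto simp: D_def[symmetric] diagonal_matrix_def)
    finally show ?thesis
      using nz[of i] by (simp add: E_def)
  qed
  then have "transpose T ** (T ** E) = transpose T ** (B ** T)"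
    by (simp add: vec_eq_iff D_def matrix_mul_assoc)
  moreover obtain T' where "T' ** transpose T = mat 1"
    using T by (metis invertible_def matrix_transpose_mul transpose_mat)
  ultimately have "B ** T = T ** E"
    by (metis matrix_mul_assoc matrix_mul_lid)
  moreover have "diagonal_matrix E"
    using B by (simp add: E_def diagonal_matrix_def)
  ultimately show thesis
    using that by blast
qed

lemma commuting_if_congruent_to_diagonal:
  fixes B C T :: "real^'n^'n"
  assumes T: "invertible T" and D: "diagonal_matrix (transpose T ** T)"
    and B: "diagonal_matrix (transpose T ** B ** T)"
    and C: "diagonal_matrix (transpose T ** C ** T)"
  shows "commuting_matrices B C"
proof -
  obtain E where E: "diagonal_matrix E" "B ** T = T ** E"
    using diagonal_congruence_imp_eigenvector_columns[OF T D B] .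
  obtain G where G: "diagonal_matrix G" "C ** T = T ** G"
    using diagonal_congruence_imp_eigenvector_columns[OF T D C] .
  have "(B ** C) ** T = (C ** B) ** T"
    using diagonal_matrices_commute[OF E(1) G(1)] E(2) G(2) by (metis matrix_mul_assoc)
  moreover obtain T' where "T ** T' = mat 1"
    using T by (auto simp: invertible_def)
  ultimately show ?thesis
    unfolding commuting_matrices_def by (metis matrix_mul_assoc matrix_mul_rid)
qed

lemma diagonal_matrix_sum:
  "(\<And>i. i \<in> I \<Longrightarrow> diagonal_matrix (M i)) \<Longrightarrow> diagonal_matrix (\<Sum>i\<in>I. l i *\<^sub>R M i)"
  by (simp add: diagonal_matrix_def)

section \<open>Simultaneous diagonalization via congruence\<close>

theorem theorem3p3:
  fixes A :: "nat \<Rightarrow> real^'n^'n"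
    and l :: "nat \<Rightarrow> real"
    and P :: "real^'n^'n"
    and m :: nat
  assumes "m \<ge> 1"
    and "\<And>i. i \<in> {1..m} \<Longrightarrow> symmetric_matrix (A i)"
    and "positive_definite (\<Sum>i=1..m. l i *\<^sub>R A i)"
    and "l m \<noteq> 0"
    and "invertible P"
    and "transpose P ** (\<Sum>i=1..m. l i *\<^sub>R A i) ** P = mat 1"
  shows "simultaneously_diagonalizable_via_congruence m A \<longleftrightarrow>
    (\<forall>i\<in>{1..m-1}. \<forall>j\<in>{1..m-1}. i \<noteq> j \<longrightarrow>
       commuting_matrices (transpose P ** A i ** P) (transpose P ** A j ** P))"
proof
  assume "simultaneously_diagonalizable_via_congruence m A"
  then obtain S :: "real^'n^'n" where S: "invertible S"
    and diag: "\<And>i. i \<in> {1..m} \<Longrightarrow> diagonal_matrix (transpose S ** A i ** S)"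
    by (auto simp: simultaneously_diagonalizable_via_congruence_def)
  obtain P' where "P ** P' = mat 1"
    using assms(5) by (auto simp: invertible_def)
  then obtain T where PT: "P ** T = S"
    by (metis matrix_mul_assoc matrix_mul_lid)
  have T: "invertible T"
    using S PT by (metis det_mul invertible_det_nz mult_zero_right)
  have B: "diagonal_matrix (transpose T ** (transpose P ** A i ** P) ** T)" if "i \<in> {1..m}" for i
    using diag[OF that] by (simp add: congruence_comp[symmetric] PT)
  have "transpose T ** T = transpose (P ** T) ** (\<Sum>i=1..m. l i *\<^sub>R A i) ** (P ** T)"
    by (simp only: congruence_comp assms(6) matrix_mul_rid)
  also have "\<dots> = (\<Sum>i=1..m. l i *\<^sub>R (transpose S ** A i ** S))"
    by (simp only: PT congruence_sum)
  finally have sum_eq: "transpose T ** T = \<dots>" .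
  have TT: "diagonal_matrix (transpose T ** T)"
    unfolding sum_eq by (rule diagonal_matrix_sum) (rule diag)
  then show "\<forall>i\<in>{1..m-1}. \<forall>j\<in>{1..m-1}. i \<noteq> j \<longrightarrow>
       commuting_matrices (transpose P ** A i ** P) (transpose P ** A j ** P)"
    using T TT B by (auto intro!: commuting_if_congruent_to_diagonal)
next
  assume comm: "\<forall>i\<in>{1..m-1}. \<forall>j\<in>{1..m-1}. i \<noteq> j \<longrightarrow>
       commuting_matrices (transpose P ** A i ** P) (transpose P ** A j ** P)"
  have "commuting_matrices (transpose P ** A i ** P) (transpose P ** A j ** P)"
    if "i \<in> {1..m-1}" "j \<in> {1..m-1}" for i j
    using comm that by (cases "i = j") (auto simp: commuting_matrices_def)
  moreover have "symmetric_matrix (transpose P ** A i ** P)" if "i \<in> {1..m-1}" for i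
    using that by (intro symmetric_matrix_congruence assms(2)) auto
  ultimately obtain Q :: "real^'n^'n" where Q: "orthogonal_matrix Q"
    and diag: "\<And>i. i \<in> {1..m-1} \<Longrightarrow>
      diagonal_matrix (transpose Q ** (transpose P ** A i ** P) ** Q)"
    using commuting_symmetric_orthogonally_diagonalizable[of "{1..m-1}" "\<lambda>i. transpose P ** A i ** P"]
    by blast
  define S where "S = P ** Q"
  have diagS: "diagonal_matrix (transpose S ** A i ** S)" if "i \<in> {1..m-1}" for i
    using diag[OF that] by (simp add: S_def congruence_comp)
  have "invertible S"
    using Q assms(5) unfolding S_def
    by (intro invertible_mult) (auto simp: orthogonal_matrix_def invertible_def)
  moreover have "diagonal_matrix (transpose S ** A m ** S)"
    unfolding diagonal_matrix_def
  proof (intro allI impI)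
    fix j k :: 'n
    assume "j \<noteq> k"
    have "(\<Sum>i=1..m. l i *\<^sub>R (transpose S ** A i ** S)) = transpose Q ** mat 1 ** Q"
      by (simp only: congruence_sum[symmetric] S_def congruence_comp assms(6))
    also have "\<dots> = mat 1"
      using Q by (simp add: orthogonal_matrix)
    finally have "(\<Sum>i=1..m. l i * (transpose S ** A i ** S) $ j $ k) = 0"
      using \<open>j \<noteq> k\<close> by (simp add: vec_eq_iff mat_def)
    moreover have "{1..m} = insert m {1..m-1}"
      using assms(1) by auto
    moreover have "m \<notin> {1..m-1}"
      using assms(1) by auto
    moreover have "(\<Sum>i=1..m-1. l i * (transpose S ** A i ** S) $ j $ k) = 0"
      using diagS \<open>j \<noteq> k\<close> by (intro sum.neutral) (auto simp: diagonal_matrix_def)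
    ultimately show "(transpose S ** A m ** S) $ j $ k = 0"
      using assms(4) by simp
  qed
  moreover have "i = m \<or> i \<in> {1..m-1}" if "i \<in> {1..m}" for i
    using that by auto
  ultimately show "simultaneously_diagonalizable_via_congruence m A"
    unfolding simultaneously_diagonalizable_via_congruence_def using diagS by blast
qed

end
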